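(* Let $\bar T^n_{h,(1)}$ be the linearly-transformed particle (LTP) transport operator, defined on particles by $\bar T^n_{h,(1)}\varphi^0_{h,k}(x) := \varphi_h\big((J^n_k)^{-1}(x-\bar F^n_{\rm ex}(x^0_k))\big)$ with $J^n_k := J_{\bar F^n_{\rm ex}}(x^0_k)$, and let $\bar T^n_{\rm ex}$ be the exact transport operator. Then $$\|(\bar T^n_{h,(1)} - \bar T^n_{\rm ex}) A_h f^0\|_{L^\infty} \le C\, h\, c^{n}_{F} \big(1+h\, c^{n}_{F}\big)^d \|f^0\|_{L^\infty},\qquad c^{n}_{F} := |\bar F^n_{\rm ex}|_1^2\, |\bar B^n_{\rm ex}|_2,$$ where the constant $C$ depends only on $d$ and $p$ (i.e. only on the dimension and the fixed choice of particle shape and approximation scheme; in particular it is independent of $h$, $f^0$, $u$ and $n$).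
   Context: **Flow.** Let $d\ge 1$, $T>0$, $\Delta t>0$, and let $u:[0,T]\times\mathbb{R}^d\to\mathbb{R}^d$ be a velocity field with $\operatorname{div} u=0$, smooth enough that the characteristic trajectories $X'(t)=u(t,X(t))$, $X(t_0)=x_0$ are defined on $[0,T]$ for all $t_0\in[0,T]$, $x_0\in\mathbb{R}^d$. The characteristic flow is $F_{t_0,t}:x_0\mapsto X(t)$; it is invertible with $(F_{t_0,t})^{-1}=F_{t,t_0}$, and $\det J_{F_{t_0,t}}=1$, where $J_F=(\partial_j F_i)_{1\le i,j\le d}$ denotes the Jacobian matrix. For $t^n=n\Delta t\in[0,T]$ set $\bar F^n_{\rm ex}:=F_{0,t^n}$ and $\bar B^n_{\rm ex}:=(\bar F^n_{\rm ex})^{-1}$. The velocity is assumed smooth enough for the derivatives and semi-norms appearing in the claim to be well defined. The exact transport operator is $\bar T^n_{\rm ex}g := g\circ \bar B^n_{\rm ex}$. **Semi-norms.** For $\omega\subset\mathbb{R}^d$, an integer $m>0$ and a vector-valued function $v$, $$|v|_{m,\omega}:=\max_i\Big\{\sum_{l_1=1}^d\cdots\sum_{l_m=1}^d\|\partial_{l_1}\cdots\partial_{l_m}v_i\|_{L^\infty(\omega)}\Big\},$$ and $|v|_m:=|v|_{m,\mathbb{R}^d}$. **Particles.** Let $h>0$, $x^0_k:=hk$ for $k\in\mathbb{Z}^d$, and for a reference shape function $\varphi:\mathbb{R}^d\to\mathbb{R}$ put $\varphi_h:=h^{-d}\varphi(h^{-1}\,\cdot)$ and $\varphi^0_{h,k}(x):=\varphi_h(x-x^0_k)=h^{-d}\varphi(h^{-1}x-k)$.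 Operators on particles are extended linearly to (locally finite) sums $\sum_k w_k\varphi^0_{h,k}$. **Shape function and approximation operator.** $f^0:\mathbb{R}^d\to\mathbb{R}$ is a bounded initial datum, defined pointwise, with $\|f^0\|_{L^\infty}=\sup|f^0|$. The pair $(\varphi,A_h)$ is one of the following. (i) B-splines of degree $p\ge1$: $\mathcal{B}_0:=\chi_{[-1/2,1/2]}$, $\mathcal{B}_p:=\mathcal{B}_{p-1}*\mathcal{B}_0$, $\varphi(x):=\prod_{i=1}^d\mathcal{B}_p(x_i)$ (supported in the closed cube $\{\|x\|_\infty\le\rho^0\}$, $\rho^0=\frac{p+1}{2}$), and $$A_h g:=\sum_{k\in\mathbb{Z}^d}w_k(g)\varphi^0_{h,k},\qquad w_k(g):=h^d\sum_{l\in\mathbb{Z}^d,\ \|l\|_\infty\le m_p}a_l\,g(x^0_{k+l}),\qquad a_l:=\prod_{i=1}^d a_{l_i},$$ where $m_p\ge0$ and the symmetric real coefficients $a_{l_i}=a_{-l_i}$ are those of the Chui–Diamond quasi-interpolation scheme: they depend only on $p$ and make $A_h$ reproduce the polynomials of coordinate degree $\le p$. For instance $m_1=0$, $a_0=1$ for $p=1$; $m_3=1$, $(a_0,a_1)=(\frac86,-\frac16)$ for $p=3$; $m_5=4$, $(a_0,\dots,a_4)=(\frac{503}{288},-\frac{1469}{3600},\frac{7}{225},\frac{13}{3600},\frac1{14400})$ for $p=5$. (ii) $M'_4$ particles: $\varphi(x)=\prod_{i=1}^d M'_4(x_i)$ with $M'_4(s)=1-\frac52|s|^2+\frac32|s|^3$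 for $0\le|s|\le1$, $M'_4(s)=\frac12(2-|s|)^2(1-|s|)$ for $1\le|s|\le2$, and $M'_4(s)=0$ otherwise (so $\rho^0=2$), and $A_h g:=\sum_k w_k(g)\varphi^0_{h,k}$ with $w_k(g):=h^d g(x^0_k)$. (In this case there is no parameter $p$ and $C$ depends only on $d$.) *)

theory Defs
  imports "HOL-Analysis.Analysis" "HOL-Probability.Essential_Supremum"
begin

definition partial :: "'d \<Rightarrow> (real^'d \<Rightarrow> real) \<Rightarrow> real^'d \<Rightarrow> real" where
  "partial l g x = deriv (\<lambda>s. g (x + s *\<^sub>R axis l 1)) 0"

definition divergence :: "(real^'d \<Rightarrow> real^'d) \<Rightarrow> real^'d \<Rightarrow> real" where
  "divergence v x = (\<Sum>i\<in>UNIV. partial i (\<lambda>y. v y $ i) x)"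

primrec Ck :: "nat \<Rightarrow> (real^'d \<Rightarrow> real) \<Rightarrow> bool" where
  "Ck 0 g \<longleftrightarrow> continuous_on UNIV g"
| "Ck (Suc m) g \<longleftrightarrow> g differentiable_on UNIV \<and> (\<forall>l. Ck m (partial l g))"

definition Ck_map :: "nat \<Rightarrow> (real^'d \<Rightarrow> real^'d) \<Rightarrow> bool" where
  "Ck_map m v \<longleftrightarrow> (\<forall>i. Ck m (\<lambda>x. v x $ i))"

text \<open>Norms and semi-norms are extended nonnegative reals, so an infinite norm is \<open>\<infinity>\<close>.\<close>

definition Linf_norm :: "(real^'d) set \<Rightarrow> (real^'d \<Rightarrow> real) \<Rightarrow> ennreal" where
  "Linf_norm \<omega> g = esssup (lebesgue_on \<omega>) (\<lambda>x. ennreal \<bar>g x\<bar>)"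

text \<open>The multi-index \<open>(l\<^sub>1, \<dots>, l\<^sub>m)\<close> is a list, and
  \<open>foldr partial [l\<^sub>1, \<dots>, l\<^sub>m] g\<close> is \<open>\<partial>\<^bsub>l\<^sub>1\<^esub> \<dots> \<partial>\<^bsub>l\<^sub>m\<^esub> g\<close>.\<close>

definition seminorm_on :: "nat \<Rightarrow> (real^'d) set \<Rightarrow> (real^'d \<Rightarrow> real^'d) \<Rightarrow> ennreal" where
  "seminorm_on m \<omega> v =
     (MAX i. \<Sum>ls | length ls = m. Linf_norm \<omega> (foldr partial ls (\<lambda>x. v x $ i)))"

abbreviation seminorm :: "nat \<Rightarrow> (real^'d \<Rightarrow> real^'d) \<Rightarrow> ennreal" where
  "seminorm m v \<equiv> seminorm_on m UNIV v"

definition characteristic ::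
  "real \<Rightarrow> (real \<Rightarrow> real^'d \<Rightarrow> real^'d) \<Rightarrow> real \<Rightarrow> real^'d \<Rightarrow> (real \<Rightarrow> real^'d) \<Rightarrow> bool" where
  "characteristic T u t0 x0 X \<longleftrightarrow>
     X t0 = x0 \<and> (\<forall>t\<in>{0..T}. (X has_vector_derivative u t (X t)) (at t within {0..T}))"

definition well_posed :: "real \<Rightarrow> (real \<Rightarrow> real^'d \<Rightarrow> real^'d) \<Rightarrow> bool" where
  "well_posed T u \<longleftrightarrow>
     (\<forall>t0\<in>{0..T}. \<forall>x0. \<exists>X. characteristic T u t0 x0 X \<and>
        (\<forall>Y. characteristic T u t0 x0 Y \<longrightarrow> (\<forall>t\<in>{0..T}. Y t = X t)))"

text \<open>Under \<open>well_posed T u\<close>, the choice below is unambiguous for all times in \<open>[0, T]\<close>.\<close>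

definition flow ::
  "real \<Rightarrow> (real \<Rightarrow> real^'d \<Rightarrow> real^'d) \<Rightarrow> real \<Rightarrow> real \<Rightarrow> real^'d \<Rightarrow> real^'d" where
  "flow T u t0 t x0 = (SOME X. characteristic T u t0 x0 X) t"

definition F_ex ::
  "real \<Rightarrow> real \<Rightarrow> (real \<Rightarrow> real^'d \<Rightarrow> real^'d) \<Rightarrow> nat \<Rightarrow> real^'d \<Rightarrow> real^'d" where
  "F_ex T \<Delta>t u n = flow T u 0 (real n * \<Delta>t)"

definition B_ex ::
  "real \<Rightarrow> real \<Rightarrow> (real \<Rightarrow> real^'d \<Rightarrow> real^'d) \<Rightarrow> nat \<Rightarrow> real^'d \<Rightarrow> real^'d" where
  "B_ex T \<Delta>t u n = inv (F_ex T \<Delta>t u n)"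

definition exact_transport ::
  "(real^'d \<Rightarrow> real^'d) \<Rightarrow> (real^'d \<Rightarrow> real) \<Rightarrow> real^'d \<Rightarrow> real" where
  "exact_transport B g = g \<circ> B"

definition grid :: "real \<Rightarrow> int^'d \<Rightarrow> real^'d" where
  "grid h k = h *\<^sub>R (\<chi> i. real_of_int (k $ i))"

definition scaled :: "(real^'d \<Rightarrow> real) \<Rightarrow> real \<Rightarrow> real^'d \<Rightarrow> real" where
  "scaled \<phi> h x = (1 / h) ^ CARD('d) * \<phi> ((1 / h) *\<^sub>R x)"

definition particle_sum ::
  "(real^'d \<Rightarrow> real) \<Rightarrow> real \<Rightarrow> (int^'d \<Rightarrow> real) \<Rightarrow> real^'d \<Rightarrow> real" where
  "particle_sum \<phi> h w x = (\<Sum>\<^sub>\<infinity>k. w k * scaled \<phi> h (x - grid h k))"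

text \<open>The LTP operator is given on single particles and extended linearly, so it acts on the
  family of weights \<open>w\<close> of a particle sum, with \<open>F\<close> the flow map.\<close>

definition ltp_transport ::
  "(real^'d \<Rightarrow> real^'d) \<Rightarrow> (real^'d \<Rightarrow> real) \<Rightarrow> real \<Rightarrow> (int^'d \<Rightarrow> real) \<Rightarrow> real^'d \<Rightarrow> real" where
  "ltp_transport F \<phi> h w x =
     (\<Sum>\<^sub>\<infinity>k. w k * scaled \<phi> h (matrix_inv (jacobian F (at (grid h k))) *v (x - F (grid h k))))"

primrec bspline :: "nat \<Rightarrow> real \<Rightarrow> real" where
  "bspline 0 = indicat_real {-1/2..1/2}"
| "bspline (Suc p) = (\<lambda>s. LINT t|lborel. bspline p (s - t) * indicat_real {-1/2..1/2} t)"

definition M4' :: "real \<Rightarrow> real" where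
  "M4' s = (if \<bar>s\<bar> \<le> 1 then 1 - 5/2 * \<bar>s\<bar>^2 + 3/2 * \<bar>s\<bar>^3
            else if \<bar>s\<bar> \<le> 2 then 1/2 * (2 - \<bar>s\<bar>)^2 * (1 - \<bar>s\<bar>)
            else 0)"

definition tensor :: "(real \<Rightarrow> real) \<Rightarrow> real^'d \<Rightarrow> real" where
  "tensor b x = (\<Prod>i\<in>UNIV. b (x $ i))"

definition quasi_weights ::
  "nat \<Rightarrow> (int \<Rightarrow> real) \<Rightarrow> real \<Rightarrow> (real^'d \<Rightarrow> real) \<Rightarrow> int^'d \<Rightarrow> real" where
  "quasi_weights m a h g k =
     h ^ CARD('d) * (\<Sum>l | \<forall>i. \<bar>l $ i\<bar> \<le> int m. (\<Prod>i\<in>UNIV. a (l $ i)) * g (grid h (k + l)))"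

definition point_weights :: "real \<Rightarrow> (real^'d \<Rightarrow> real) \<Rightarrow> int^'d \<Rightarrow> real" where
  "point_weights h g k = h ^ CARD('d) * g (grid h k)"

definition coord_polys :: "nat \<Rightarrow> (real^'d \<Rightarrow> real) set" where
  "coord_polys p =
     {g. \<exists>c. g = (\<lambda>x. \<Sum>\<alpha> | \<forall>i. \<alpha> i \<le> p. c \<alpha> * (\<Prod>i\<in>UNIV. (x $ i) ^ \<alpha> i))}"

definition reproduces_polys ::
  "nat \<Rightarrow> (real^'d \<Rightarrow> real) \<Rightarrow> (real \<Rightarrow> (real^'d \<Rightarrow> real) \<Rightarrow> int^'d \<Rightarrow> real) \<Rightarrow> bool" where
  "reproduces_polys p \<phi> W \<longleftrightarrow>
     (\<forall>h>0. \<forall>g\<in>coord_polys p. particle_sum \<phi> h (W h g) = g)"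

text \<open>A scheme is a shape \<open>\<phi>\<close> together with the map \<open>W\<close> sending \<open>h\<close> and \<open>g\<close> to the weights of
  \<open>A\<^sub>h g\<close>, so that \<open>A\<^sub>h g = particle_sum \<phi> h (W h g)\<close>. For B-splines of degree \<open>p\<close>, every
  symmetric family of coefficients reproducing the polynomials of coordinate degree at most \<open>p\<close>
  is admitted; the Chui--Diamond coefficients are one such family for each \<open>p\<close>.\<close>

inductive particle_scheme ::
  "(real^'d \<Rightarrow> real) \<Rightarrow> (real \<Rightarrow> (real^'d \<Rightarrow> real) \<Rightarrow> int^'d \<Rightarrow> real) \<Rightarrow> bool" where
  Bspline: "particle_scheme (tensor (bspline p)) (quasi_weights m a)"
    if "p \<ge> 1" "\<And>j. a (- j) = a j"
       "reproduces_polys p (tensor (bspline p) :: real^'d \<Rightarrow> real) (quasi_weights m a)"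
| M4': "particle_scheme (tensor M4') point_weights"

end

theory Submission
  imports Defs
begin

text \<open>
  Write \<open>x\<^sub>k = grid h k\<close> and \<open>y\<^sub>k = F x\<^sub>k\<close>. The Jacobian of \<open>F\<close> at \<open>x\<^sub>k\<close> has the Jacobian of \<open>B\<close> at
  \<open>y\<^sub>k\<close> as its inverse (\<open>jacobian_inverse\<close>), so the two transported particles are the scaled shape
  evaluated at \<open>D B (y\<^sub>k) (x - y\<^sub>k)\<close> and at \<open>B x - x\<^sub>k = B x - B y\<^sub>k\<close>. These arguments differ by the
  second-order Taylor remainder of \<open>B\<close> at \<open>y\<^sub>k\<close>, at most \<open>|B|\<^sub>2 * r\<^sup>2\<close> when \<open>x\<close> has distance at most
  \<open>r\<close> from \<open>y\<^sub>k\<close> in the maximum norm (\<open>linearised_position_error\<close>). If one of the two particles does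
  not vanish at \<open>x\<close>, then one of the arguments is at most \<open>h * \<rho>\<close>, and mapping it forward by \<open>F\<close> or
  its Jacobian gives \<open>r \<le> |F|\<^sub>1 * h * \<rho>\<close> (\<open>displacement_le\<close>). The arguments therefore differ by at most
  \<open>h\<^sup>2 * \<rho>\<^sup>2 * c\<^sub>F\<close>.

  The shape is a tensor product of Lipschitz functions, so the scaled shape has Lipschitz constant of
  order \<open>h ^ (- d - 1)\<close>, while the weights are of order \<open>h ^ d\<close> times the supremum of \<open>\<bar>f0\<bar>\<close>. Each term
  thus contributes an error of order \<open>h * c\<^sub>F\<close> (\<open>term_error\<close>). The terms that do not vanish at \<open>x\<close>
  belong to grid points within \<open>h * \<rho> * (1 + \<rho> * h * c\<^sub>F)\<close> of \<open>B x\<close>, of which there are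
  \<open>O((1 + h * c\<^sub>F) ^ d)\<close> (\<open>relevant_card\<close>). Summing gives the bound at every point
  (\<open>transport_error_pointwise\<close>).

  The norms take values in the extended nonnegative reals, and there the degenerate products
  \<open>0 * \<infinity> = 0\<close> need an argument of their own: if \<open>|B|\<^sub>2 = 0\<close> the error vanishes identically
  (\<open>ltp_exact_if_affine\<close>), and \<open>|F|\<^sub>1 = 0\<close> is impossible for a bijection (\<open>gradient_bound_nonzero\<close>).
\<close>


section \<open>Mean value estimates in coordinates\<close>

lemma has_derivative_partial_sum:
  fixes g :: "real^'d \<Rightarrow> real"
  assumes "g differentiable at x"
  shows "(g has_derivative (\<lambda>v. \<Sum>j\<in>UNIV. partial j g x * v $ j)) (at x)"
proof -
  obtain g' where g': "(g has_derivative g') (at x)"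
    using assms unfolding differentiable_def by blast
  interpret g': bounded_linear g' using g' by (rule has_derivative_bounded_linear)
  have part: "partial j g x = g' (axis j 1)" for j
  proof -
    have "((\<lambda>s. x + s *\<^sub>R axis j 1) has_derivative (\<lambda>s. s *\<^sub>R axis j 1)) (at (0::real))"
      by (auto intro!: derivative_eq_intros)
    moreover have "(g has_derivative g') (at (x + 0 *\<^sub>R axis j (1::real)))"
      using g' by simp
    ultimately have "((\<lambda>s. g (x + s *\<^sub>R axis j 1)) has_derivative (\<lambda>s. g' (s *\<^sub>R axis j 1))) (at 0)"
      by (rule has_derivative_compose)
    then have "((\<lambda>s. g (x + s *\<^sub>R axis j 1)) has_real_derivative g' (axis j 1)) (at 0)"
      by (simp add: has_field_derivative_def g'.scaleR mult_commute_abs)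
    then show ?thesis unfolding partial_def by (rule DERIV_imp_deriv)
  qed
  have "g' v = (\<Sum>j\<in>UNIV. partial j g x * v $ j)" for v
  proof -
    have "g' v = g' (\<Sum>j\<in>UNIV. v $ j *s axis j 1)" by (simp add: basis_expansion)
    also have "\<dots> = (\<Sum>j\<in>UNIV. partial j g x * v $ j)"
      by (simp add: g'.sum part scalar_mult_eq_scaleR g'.scaleR mult.commute)
    finally show ?thesis .
  qed
  then have "g' = (\<lambda>v. \<Sum>j\<in>UNIV. partial j g x * v $ j)" by blast
  then show ?thesis using g' by simp
qed

lemma has_real_derivative_along_line:
  fixes g :: "real^'d \<Rightarrow> real"
  assumes "g differentiable_on UNIV"
  shows "((\<lambda>t. g (y + t *\<^sub>R v)) has_real_derivative
           (\<Sum>j\<in>UNIV. partial j g (y + t *\<^sub>R v) * v $ j)) (at t)"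
proof -
  have "g differentiable at (y + t *\<^sub>R v)"
    using assms by (simp add: differentiable_on_def)
  from has_derivative_partial_sum[OF this]
  have "((\<lambda>t. g (y + t *\<^sub>R v)) has_derivative
       (\<lambda>s. \<Sum>j\<in>UNIV. partial j g (y + t *\<^sub>R v) * (s *\<^sub>R v) $ j)) (at t)"
    by (rule has_derivative_compose[rotated]) (auto intro!: derivative_eq_intros)
  moreover have "(\<lambda>s. \<Sum>j\<in>UNIV. partial j g (y + t *\<^sub>R v) * (s *\<^sub>R v) $ j)
      = (*) (\<Sum>j\<in>UNIV. partial j g (y + t *\<^sub>R v) * v $ j)"
    by (rule ext) (simp add: sum_distrib_left mult_ac)
  ultimately show ?thesis
    unfolding has_field_derivative_def by simp
qed

lemma abs_sum_mult_le:
  fixes a c :: "'i \<Rightarrow> real"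
  assumes "(\<Sum>j\<in>S. \<bar>a j\<bar>) \<le> A" "\<And>j. j \<in> S \<Longrightarrow> \<bar>c j\<bar> \<le> r" "0 \<le> r"
  shows "\<bar>\<Sum>j\<in>S. a j * c j\<bar> \<le> A * r"
proof -
  have "\<bar>\<Sum>j\<in>S. a j * c j\<bar> \<le> (\<Sum>j\<in>S. \<bar>a j * c j\<bar>)" by (rule sum_abs)
  also have "\<dots> \<le> (\<Sum>j\<in>S. \<bar>a j\<bar> * r)"
    by (rule sum_mono) (auto simp: abs_mult intro!: mult_left_mono assms)
  also have "\<dots> = (\<Sum>j\<in>S. \<bar>a j\<bar>) * r" by (simp add: sum_distrib_right)
  also have "\<dots> \<le> A * r" by (intro mult_right_mono assms)
  finally show ?thesis .
qed

text \<open>Distances are measured in the maximum norm throughout, because it is the norm dual to the sums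
  over multi-indices in the semi-norms.\<close>

lemma increment_bound:
  fixes g :: "real^'d \<Rightarrow> real"
  assumes g: "g differentiable_on UNIV"
    and A: "\<And>x. (\<Sum>j\<in>UNIV. \<bar>partial j g x\<bar>) \<le> A"
    and r: "\<And>j. \<bar>(x - y) $ j\<bar> \<le> r"
  shows "\<bar>g x - g y\<bar> \<le> A * r"
proof -
  have "0 \<le> r" using r[of undefined] by linarith
  obtain z where "g (y + 1 *\<^sub>R (x - y)) - g (y + 0 *\<^sub>R (x - y))
      = (1 - 0) * (\<Sum>j\<in>UNIV. partial j g (y + z *\<^sub>R (x - y)) * (x - y) $ j)"
    using MVT2[of 0 1 "\<lambda>t. g (y + t *\<^sub>R (x - y))"] has_real_derivative_along_line[OF g] by force
  then have "g x - g y = (\<Sum>j\<in>UNIV. partial j g (y + z *\<^sub>R (x - y)) * (x - y) $ j)" by simp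
  then show ?thesis
    using abs_sum_mult_le[OF A[of "y + z *\<^sub>R (x - y)"] r \<open>0 \<le> r\<close>] by simp
qed

text \<open>The two nested mean value steps give \<open>G 1 - G 0 - G' 0 = z * G'' w\<close> with \<open>0 < z < 1\<close> for the
  restriction \<open>G\<close> of \<open>g\<close> to the segment from \<open>y\<close> to \<open>x\<close>. The factor \<open>1/2\<close> of Taylor's formula is
  given up, since constants are absorbed in the final estimate anyway.\<close>

lemma linearisation_bound:
  fixes g :: "real^'d \<Rightarrow> real"
  assumes g: "g differentiable_on UNIV" "\<And>j. partial j g differentiable_on UNIV"
    and \<beta>: "\<And>x. (\<Sum>j\<in>UNIV. \<Sum>l\<in>UNIV. \<bar>partial l (partial j g) x\<bar>) \<le> \<beta>"
    and r: "\<And>j. \<bar>(x - y) $ j\<bar> \<le> r"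
  shows "\<bar>g x - g y - (\<Sum>j\<in>UNIV. partial j g y * (x - y) $ j)\<bar> \<le> \<beta> * r\<^sup>2"
proof -
  define v where "v = x - y"
  define G' where "G' t = (\<Sum>j\<in>UNIV. partial j g (y + t *\<^sub>R v) * v $ j)" for t
  define G'' where "G'' t = (\<Sum>j\<in>UNIV. (\<Sum>l\<in>UNIV. partial l (partial j g) (y + t *\<^sub>R v) * v $ l) * v $ j)" for t
  have "0 \<le> r" using r[of undefined] by linarith
  have dG: "((\<lambda>t. g (y + t *\<^sub>R v)) has_real_derivative G' t) (at t)" for t
    unfolding G'_def by (rule has_real_derivative_along_line[OF g(1)])
  have dG': "(G' has_real_derivative G'' t) (at t)" for t
    unfolding G'_def G''_def
    by (intro DERIV_sum DERIV_cmult_right has_real_derivative_along_line g(2))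
  have G''_le: "\<bar>G'' t\<bar> \<le> \<beta> * r\<^sup>2" for t
  proof -
    have "\<bar>G'' t\<bar> \<le> (\<Sum>j\<in>UNIV. \<bar>\<Sum>l\<in>UNIV. partial l (partial j g) (y + t *\<^sub>R v) * v $ l\<bar>) * r"
      unfolding G''_def by (rule abs_sum_mult_le) (use r \<open>0 \<le> r\<close> in \<open>auto simp: v_def\<close>)
    also have "\<dots> \<le> (\<Sum>j\<in>UNIV. (\<Sum>l\<in>UNIV. \<bar>partial l (partial j g) (y + t *\<^sub>R v)\<bar>) * r) * r"
      by (intro mult_right_mono sum_mono abs_sum_mult_le) (use r \<open>0 \<le> r\<close> in \<open>auto simp: v_def\<close>)
    also have "\<dots> = (\<Sum>j\<in>UNIV. (\<Sum>l\<in>UNIV. \<bar>partial l (partial j g) (y + t *\<^sub>R v)\<bar>)) * r\<^sup>2"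
      by (simp add: sum_distrib_right power2_eq_square mult.assoc)
    also have "\<dots> \<le> \<beta> * r\<^sup>2" by (intro mult_right_mono \<beta>) simp
    finally show ?thesis .
  qed
  obtain z where z: "0 < z" "z < 1" "g (y + 1 *\<^sub>R v) - g (y + 0 *\<^sub>R v) = (1 - 0) * G' z"
    using MVT2[of 0 1 "\<lambda>t. g (y + t *\<^sub>R v)" G'] dG by force
  obtain w where w: "G' z - G' 0 = (z - 0) * G'' w"
    using MVT2[of 0 z G' G''] dG' z by force
  have "g x - g y - (\<Sum>j\<in>UNIV. partial j g y * (x - y) $ j) = z * G'' w"
    using z(3) w by (simp add: v_def G'_def)
  then have "\<bar>g x - g y - (\<Sum>j\<in>UNIV. partial j g y * (x - y) $ j)\<bar> = z * \<bar>G'' w\<bar>"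
    using z by (simp add: abs_mult)
  also have "\<dots> \<le> 1 * \<bar>G'' w\<bar>" using z by (intro mult_right_mono) auto
  finally show ?thesis using G''_le[of w] by simp
qed

lemma differentiable_iff_components:
  fixes F :: "real^'d \<Rightarrow> real^'e"
  shows "F differentiable at x \<longleftrightarrow> (\<forall>i. (\<lambda>x. F x $ i) differentiable at x)"
  by (subst differentiable_componentwise_within) (auto simp: Basis_vec_def inner_axis)

lemma jacobian_entry:
  fixes F :: "real^'d \<Rightarrow> real^'e"
  assumes "F differentiable at x"
  shows "jacobian F (at x) $ i $ j = partial j (\<lambda>x. F x $ i) x"
proof -
  have "(F has_derivative (\<lambda>h. jacobian F (at x) *v h)) (at x)"
    using assms jacobian_works by blast
  then have 1: "((\<lambda>x. F x $ i) has_derivative (\<lambda>h. (jacobian F (at x) *v h) $ i)) (at x)"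
    by (rule bounded_linear.has_derivative[OF bounded_linear_vec_nth])
  have "(\<lambda>x. F x $ i) differentiable at x" using assms differentiable_iff_components by blast
  from has_derivative_unique[OF 1 has_derivative_partial_sum[OF this]]
  have "(jacobian F (at x) *v axis j 1) $ i = (\<Sum>k\<in>UNIV. partial k (\<lambda>x. F x $ i) x * axis j 1 $ k)"
    by meson
  then show ?thesis
    by (simp add: matrix_vector_mult_def axis_def if_distrib cong: if_cong)
qed

lemma matrix_inv_eq:
  fixes M N :: "real^'d^'d"
  assumes "M ** N = mat 1" "N ** M = mat 1"
  shows "matrix_inv M = N"
proof -
  have "M ** matrix_inv M = mat 1 \<and> matrix_inv M ** M = mat 1"
    unfolding matrix_inv_def by (rule someI[of _ N]) (use assms in simp)
  then have "N ** (M ** matrix_inv M) = N" by simp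
  then show ?thesis using assms by (simp add: matrix_mul_assoc)
qed

text \<open>The chain rule turns the inverse of the Jacobian of \<open>F\<close> into the Jacobian of \<open>B\<close>. Hence the LTP
  particle is the exactly transported one with \<open>B\<close> replaced by its linearisation.\<close>

lemma jacobian_inverse:
  fixes F B :: "real^'d \<Rightarrow> real^'d"
  assumes BF: "\<And>x. B (F x) = x"
    and "F differentiable at x" "B differentiable at (F x)"
  shows "jacobian B (at (F x)) ** jacobian F (at x) = mat 1"
    and "jacobian F (at x) ** jacobian B (at (F x)) = mat 1"
    and "matrix_inv (jacobian F (at x)) = jacobian B (at (F x))"
proof -
  have "((\<lambda>x. B (F x)) has_derivative
      (\<lambda>h. jacobian B (at (F x)) *v (jacobian F (at x) *v h))) (at x)"
    using assms(2,3)[unfolded jacobian_works] by (rule has_derivative_compose)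
  moreover have "((\<lambda>x. B (F x)) has_derivative (\<lambda>h. h)) (at x)" by (simp add: BF)
  ultimately have "(\<lambda>h. jacobian B (at (F x)) *v (jacobian F (at x) *v h)) = (\<lambda>h. h)"
    by (rule has_derivative_unique)
  then have "(jacobian B (at (F x)) ** jacobian F (at x)) *v h = mat 1 *v h" for h
    by (simp add: matrix_vector_mul_assoc[symmetric] fun_eq_iff)
  then show 1: "jacobian B (at (F x)) ** jacobian F (at x) = mat 1"
    by (subst matrix_eq) blast
  then show 2: "jacobian F (at x) ** jacobian B (at (F x)) = mat 1"
    using matrix_left_right_inverse by blast
  show "matrix_inv (jacobian F (at x)) = jacobian B (at (F x))"
    using 2 1 by (rule matrix_inv_eq)
qed

section \<open>Semi-norms as pointwise bounds\<close>

text \<open>A closed set that contains almost every point is everything, so for continuous functions the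
  essential supremum is a bound at every point. Pointwise bounds are needed because the linearisation
  takes place at grid points and along segments, which are null sets.\<close>

lemma Linf_norm_ge_pointwise:
  fixes g :: "real^'d \<Rightarrow> real"
  assumes "continuous_on UNIV g"
  shows "ennreal \<bar>g x\<bar> \<le> Linf_norm UNIV g"
proof -
  have "AE x in lebesgue. x \<in> {x. ennreal \<bar>g x\<bar> \<le> Linf_norm UNIV g}"
    using esssup_AE[of "\<lambda>x. ennreal \<bar>g x\<bar>" "lebesgue_on UNIV"]
    by (simp add: Linf_norm_def AE_restrict_space_iff)
  moreover have "closed {x. ennreal \<bar>g x\<bar> \<le> Linf_norm UNIV g}"
    by (intro closed_Collect_le continuous_on_ennreal continuous_intros assms)
  ultimately show ?thesis using mem_closed_if_AE_lebesgue by blast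
qed

text \<open>Measurability matters here: the essential supremum of a non-measurable function is infinite by
  definition.\<close>

lemma Linf_norm_leI:
  fixes g :: "real^'d \<Rightarrow> real"
  assumes "g \<in> borel_measurable borel" "\<And>x. ennreal \<bar>g x\<bar> \<le> c"
  shows "Linf_norm UNIV g \<le> c"
  unfolding Linf_norm_def
proof (rule esssup_I)
  have "g \<in> borel_measurable lebesgue"
    using assms(1) by (simp add: measurable_completion)
  then show "(\<lambda>x. ennreal \<bar>g x\<bar>) \<in> borel_measurable (lebesgue_on UNIV)"
    by (intro measurable_restrict_space1) simp
qed (simp add: assms)

text \<open>\<open>Ck\<close> peels off the derivative that is taken first, which is the last entry of the multi-index;
  so the induction splits the list from the right.\<close>

lemma Ck_iterated_partial_continuous:
  assumes "Ck m g" "length ls = m"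
  shows "continuous_on UNIV (foldr partial ls g)"
  using assms
proof (induction m arbitrary: g ls)
  case (Suc m)
  then obtain ls' l where "ls = ls' @ [l]" by (metis append_butlast_last_id list.size(3) nat.distinct(1))
  then show ?case using Suc by simp
qed simp

lemma sum_lists_Suc:
  fixes f :: "'a::finite list \<Rightarrow> 'b::comm_monoid_add"
  shows "(\<Sum>ls | length ls = Suc m. f ls) = (\<Sum>j\<in>UNIV. \<Sum>ls | length ls = m. f (j # ls))"
proof -
  have "{ls :: 'a list. length ls = Suc m} = (\<lambda>(j, ls). j # ls) ` (UNIV \<times> {ls. length ls = m})"
    by (auto simp: length_Suc_conv)
  then have "(\<Sum>ls | length ls = Suc m. f ls) = (\<Sum>(j, ls)\<in>UNIV \<times> {ls. length ls = m}. f (j # ls))"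
    by (simp add: sum.reindex inj_on_def case_prod_beta)
  also have "\<dots> = (\<Sum>j\<in>UNIV. \<Sum>ls | length ls = m. f (j # ls))"
    by (simp add: sum.cartesian_product)
  finally show ?thesis .
qed

lemma seminorm_ge_pointwise:
  fixes v :: "real^'d \<Rightarrow> real^'d"
  assumes "Ck_map m v" "seminorm m v = ennreal A" "0 \<le> A"
  shows "(\<Sum>ls | length ls = m. \<bar>foldr partial ls (\<lambda>x. v x $ i) x\<bar>) \<le> A"
proof -
  have "ennreal (\<Sum>ls | length ls = m. \<bar>foldr partial ls (\<lambda>x. v x $ i) x\<bar>)
      = (\<Sum>ls | length ls = m. ennreal \<bar>foldr partial ls (\<lambda>x. v x $ i) x\<bar>)"
    by (simp add: sum_ennreal)
  also have "\<dots> \<le> (\<Sum>ls | length ls = m. Linf_norm UNIV (foldr partial ls (\<lambda>x. v x $ i)))"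
    using assms(1) unfolding Ck_map_def
    by (intro sum_mono Linf_norm_ge_pointwise) (auto intro: Ck_iterated_partial_continuous)
  also have "\<dots> \<le> seminorm m v"
    unfolding seminorm_on_def by (rule Max_ge) auto
  finally show ?thesis using assms by (simp add: ennreal_le_iff)
qed

lemma seminorm_1_bound:
  fixes v :: "real^'d \<Rightarrow> real^'d"
  assumes "Ck_map 1 v" "seminorm 1 v = ennreal A" "0 \<le> A"
  shows "(\<Sum>j\<in>UNIV. \<bar>partial j (\<lambda>x. v x $ i) x\<bar>) \<le> A"
  using seminorm_ge_pointwise[OF assms, of i x] by (simp add: sum_lists_Suc)

lemma seminorm_2_bound:
  fixes v :: "real^'d \<Rightarrow> real^'d"
  assumes "Ck_map 2 v" "seminorm 2 v = ennreal \<beta>" "0 \<le> \<beta>"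
  shows "(\<Sum>j\<in>UNIV. \<Sum>l\<in>UNIV. \<bar>partial l (partial j (\<lambda>x. v x $ i)) x\<bar>) \<le> \<beta>"
  using seminorm_ge_pointwise[OF assms, of i x]
  by (subst sum.swap) (simp add: sum_lists_Suc numeral_2_eq_2)

lemma Ck_map_differentiable:
  assumes "Ck_map (Suc m) v"
  shows "v differentiable at x" "(\<lambda>x. v x $ i) differentiable_on UNIV"
  using assms by (auto simp: Ck_map_def differentiable_iff_components differentiable_on_def)

section \<open>The flow map is a bijection\<close>

lemma flow_characteristic:
  assumes "well_posed T u" "t0 \<in> {0..T}"
  shows "characteristic T u t0 x0 (\<lambda>t. flow T u t0 t x0)"
proof -
  have "\<exists>X. characteristic T u t0 x0 X" using assms unfolding well_posed_def by blast
  then show ?thesis unfolding flow_def by (rule someI_ex)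
qed

lemma characteristic_unique:
  assumes "well_posed T u" "t0 \<in> {0..T}" "t \<in> {0..T}"
    and "characteristic T u t0 x0 X" "characteristic T u t0 x0 Y"
  shows "X t = Y t"
  using assms unfolding well_posed_def by metis

lemma characteristic_restart:
  assumes "characteristic T u t0 x0 X"
  shows "characteristic T u t1 (X t1) X"
  using assms by (simp add: characteristic_def)

text \<open>Time can be reversed: \<open>flow T u t1 t0\<close> is the inverse of \<open>flow T u t0 t1\<close>, because a trajectory
  is a trajectory from each of its points.\<close>

lemma bij_flow:
  assumes wp: "well_posed T u" and t: "t0 \<in> {0..T}" "t1 \<in> {0..T}"
  shows "bij (flow T u t0 t1)"
proof (rule bijI)
  note flow = flow_characteristic[OF wp]
  show "inj (flow T u t0 t1)"
  proof (rule injI)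
    fix x y assume "flow T u t0 t1 x = flow T u t0 t1 y"
    then have "flow T u t0 t0 x = flow T u t0 t0 y"
      using characteristic_unique[OF wp t(2,1)] characteristic_restart[OF flow[OF t(1)], of t1]
      by metis
    then show "x = y" using flow[OF t(1)] by (simp add: characteristic_def)
  qed
  show "surj (flow T u t0 t1)"
  proof (rule surjI)
    fix z
    have "characteristic T u t0 (flow T u t1 t0 z) (\<lambda>t. flow T u t1 t z)"
      using characteristic_restart[OF flow[OF t(2)]] .
    then have "flow T u t0 t1 (flow T u t1 t0 z) = flow T u t1 t1 z"
      using characteristic_unique[OF wp t flow[OF t(1)]] by blast
    then show "flow T u t0 t1 (flow T u t1 t0 z) = z"
      using flow[OF t(2)] by (simp add: characteristic_def)
  qed
qed

section \<open>Shape functions\<close>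

text \<open>The bound by \<open>1\<close> is chosen so that differences of tensor products telescope into sums of
  one-dimensional differences without further constants.\<close>

definition lipschitz_profile :: "real \<Rightarrow> real \<Rightarrow> (real \<Rightarrow> real) \<Rightarrow> bool" where
  "lipschitz_profile \<rho> L b \<longleftrightarrow>
     (\<forall>s. \<bar>b s\<bar> \<le> 1) \<and> (\<forall>s. \<bar>s\<bar> > \<rho> \<longrightarrow> b s = 0) \<and> (\<forall>s t. \<bar>b s - b t\<bar> \<le> L * \<bar>s - t\<bar>)"

lemma window_average_swap:
  fixes f :: "real \<Rightarrow> real"
  shows "(LINT t|lborel. f (s - t) * indicat_real {-1/2..1/2} t)
       = (LINT t|lborel. f t * indicat_real {s - 1/2..s + 1/2} t)"
proof -
  have "(LINT t|lborel. f (s - t) * indicat_real {-1/2..1/2} t)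
      = (LINT t|lborel. f t * indicat_real {-1/2..1/2} (s - t))"
    by (subst lborel_integral_real_affine[of "-1" _ s]) (auto simp: algebra_simps)
  also have "\<dots> = (LINT t|lborel. f t * indicat_real {s - 1/2..s + 1/2} t)"
    by (rule Bochner_Integration.integral_cong) (auto simp: indicator_def)
  finally show ?thesis .
qed

lemma integrable_bounded_on_interval:
  fixes f :: "real \<Rightarrow> real"
  assumes "f \<in> borel_measurable borel" "\<And>s. \<bar>f s\<bar> \<le> 1"
  shows "integrable lborel (\<lambda>t. f t * indicat_real {a..b} t)"
proof (rule Bochner_Integration.integrable_bound)
  show "integrable lborel (indicat_real {a..b})"
    by (cases "a \<le> b") auto
  show "AE t in lborel. norm (f t * indicat_real {a..b} t) \<le> norm (indicat_real {a..b} t)"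
    using assms(2) by (auto simp: indicator_def)
qed (use assms in measurable)

text \<open>Averaging over a window of length one is the step from one B-spline to the next. The averages at
  \<open>s\<close> and \<open>t\<close> differ by the integral over the symmetric difference of two windows, which has length
  at most \<open>2 * \<bar>s - t\<bar>\<close>. So even the discontinuous
  \<open>bspline 0\<close> has a Lipschitz average.\<close>

lemma window_average_lipschitz_profile:
  fixes f :: "real \<Rightarrow> real"
  assumes meas: "f \<in> borel_measurable borel" and le1: "\<And>s. \<bar>f s\<bar> \<le> 1"
    and supp: "\<And>s. \<bar>s\<bar> > \<rho> \<Longrightarrow> f s = 0"
  shows "lipschitz_profile (\<rho> + 1/2) 2
           (\<lambda>s. LINT t|lborel. f (s - t) * indicat_real {-1/2..1/2} t)"
    (is "lipschitz_profile _ _ ?g")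
  unfolding lipschitz_profile_def
proof (intro conjI allI impI)
  note int = integrable_bounded_on_interval[OF meas le1]
  have one: "integrable lborel (indicat_real {a..b})" for a b :: real
    using integrable_bounded_on_interval[of "\<lambda>_. 1" a b] by simp
  fix s
  have "\<bar>?g s\<bar> \<le> (LINT t|lborel. \<bar>f t * indicat_real {s - 1/2..s + 1/2} t\<bar>)"
    unfolding window_average_swap by (rule integral_abs_bound)
  also have "\<dots> \<le> (LINT t|lborel. indicat_real {s - 1/2..s + 1/2} t)"
    by (intro integral_mono integrable_abs int one) (use le1 in \<open>auto simp: indicator_def\<close>)
  also have "\<dots> = 1" by simp
  finally show "\<bar>?g s\<bar> \<le> 1" .
  show "?g s = 0" if "\<bar>s\<bar> > \<rho> + 1/2"
  proof -
    have *: "f (s - t) * indicat_real {-1/2..1/2} t = 0" for t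
    proof (cases "t \<in> {-1/2..1/2}")
      case True
      then have "\<bar>s - t\<bar> > \<rho>" using that by auto
      then show ?thesis using supp by simp
    qed simp
    show ?thesis unfolding * by simp
  qed
  have lip: "\<bar>?g s - ?g t\<bar> \<le> 2 * (t - s)" if "s \<le> t" for s t
  proof -
    let ?I = "\<lambda>s. indicat_real {s - 1/2..s + 1/2}"
    let ?S = "\<lambda>x. indicat_real {s - 1/2..t - 1/2} x + indicat_real {s + 1/2..t + 1/2} x"
    have "\<bar>?g s - ?g t\<bar> = \<bar>LINT x|lborel. f x * ?I s x - f x * ?I t x\<bar>"
      unfolding window_average_swap by (subst Bochner_Integration.integral_diff) (auto intro: int)
    also have "\<dots> \<le> (LINT x|lborel. \<bar>f x * ?I s x - f x * ?I t x\<bar>)"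
      by (rule integral_abs_bound)
    also have "\<dots> \<le> (LINT x|lborel. ?S x)"
      by (intro integral_mono integrable_abs Bochner_Integration.integrable_diff
          Bochner_Integration.integrable_add int one)
         (use le1 that in \<open>auto simp: indicator_def intro: order_trans[OF le1]\<close>)
    also have "\<dots> = 2 * (t - s)"
      using that by (subst Bochner_Integration.integral_add) (auto intro: one)
    finally show ?thesis .
  qed
  fix t
  show "\<bar>?g s - ?g t\<bar> \<le> 2 * \<bar>s - t\<bar>"
    using lip[of s t] lip[of t s] by (cases "s \<le> t") (auto simp: abs_minus_commute)
qed

lemma lipschitz_profile_continuous:
  assumes "lipschitz_profile \<rho> L b"
  shows "continuous_on UNIV b"
proof -
  have "0 \<le> \<bar>b 1 - b 0\<bar>" by simp
  also have "\<dots> \<le> L * \<bar>1 - 0\<bar>" using assms unfolding lipschitz_profile_def by blast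
  finally have "0 \<le> L" by simp
  then have "L-lipschitz_on UNIV b"
    using assms by (intro lipschitz_onI) (auto simp: lipschitz_profile_def dist_real_def)
  then show ?thesis by (rule lipschitz_on_continuous_on)
qed

text \<open>The induction carries only boundedness, measurability and the support, since \<open>bspline 0\<close> jumps;
  one more average then makes every later spline Lipschitz.\<close>

lemma bspline_lipschitz_profile: "lipschitz_profile ((real p + 2) / 2) 2 (bspline (Suc p))"
proof -
  have "bspline p \<in> borel_measurable borel \<and> (\<forall>s. \<bar>bspline p s\<bar> \<le> 1)
      \<and> (\<forall>s. \<bar>s\<bar> > (real p + 1) / 2 \<longrightarrow> bspline p s = 0)"
  proof (induction p)
    case 0
    show ?case by (auto simp: indicator_def)
  next
    case (Suc p)
    then have "lipschitz_profile ((real p + 1) / 2 + 1/2) 2 (bspline (Suc p))"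
      unfolding bspline.simps by (intro window_average_lipschitz_profile) auto
    moreover from this have "bspline (Suc p) \<in> borel_measurable borel"
      by (intro borel_measurable_continuous_onI lipschitz_profile_continuous)
    moreover have "(real p + 1) / 2 + 1/2 = (real (Suc p) + 1) / 2" by (simp add: field_simps)
    ultimately show ?case
      unfolding lipschitz_profile_def by (simp del: bspline.simps)
  qed
  then have "lipschitz_profile ((real p + 1) / 2 + 1/2) 2 (bspline (Suc p))"
    unfolding bspline.simps by (intro window_average_lipschitz_profile) auto
  then show ?thesis by (simp add: add_divide_distrib add.commute)
qed

text \<open>\<open>M4'\<close> is the sum of two polynomials evaluated at clamped arguments, \<open>P\<close> on \<open>[0, 1]\<close> and
  \<open>Q\<close> on \<open>[1, 2]\<close>, because \<open>P 1 = 0\<close> and \<open>Q 1 = Q 2 = 0\<close>. Clamping does not increase distances, so the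
  Lipschitz constants of the two pieces add up, without a case distinction across the knots.\<close>

lemma M4'_lipschitz_profile: "lipschitz_profile 2 20 M4'"
proof -
  define P :: "real \<Rightarrow> real" where "P a = 1 - 5/2 * a^2 + 3/2 * a^3" for a
  define Q :: "real \<Rightarrow> real" where "Q a = 1/2 * (2 - a)^2 * (1 - a)" for a
  define lo :: "real \<Rightarrow> real" where "lo s = min \<bar>s\<bar> 1" for s
  define hi :: "real \<Rightarrow> real" where "hi s = max 1 (min \<bar>s\<bar> 2)" for s
  have eq: "M4' s = P (lo s) + Q (hi s)" for s
    by (auto simp: M4'_def P_def Q_def lo_def hi_def min_def max_def)
  have P: "\<bar>P a - P b\<bar> \<le> 10 * \<bar>a - b\<bar>" if "0 \<le> a" "a \<le> 1" "0 \<le> b" "b \<le> 1" for a b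
  proof -
    have "P a - P b = (3/2 * (a*a + a*b + b*b) - 5/2 * (a + b)) * (a - b)"
      unfolding P_def by (simp add: power2_eq_square power3_eq_cube field_simps)
    moreover have "\<bar>3/2 * (a*a + a*b + b*b) - 5/2 * (a + b)\<bar> \<le> 10"
    proof -
      have "0 \<le> a*a" "0 \<le> a*b" "0 \<le> b*b" "a*a \<le> 1" "a*b \<le> 1" "b*b \<le> 1"
        using that by (auto intro: mult_le_one)
      then show ?thesis using that unfolding abs_le_iff distrib_left by (intro conjI; linarith)
    qed
    ultimately show ?thesis by (simp add: abs_mult mult_right_mono)
  qed
  have Q: "\<bar>Q a - Q b\<bar> \<le> 10 * \<bar>a - b\<bar>" if "1 \<le> a" "a \<le> 2" "1 \<le> b" "b \<le> 2" for a b
  proof -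
    have "Q a - Q b = (5/2 * (a + b) - 4 - 1/2 * (a*a + a*b + b*b)) * (a - b)"
      unfolding Q_def by (simp add: power2_eq_square field_simps)
    moreover have "\<bar>5/2 * (a + b) - 4 - 1/2 * (a*a + a*b + b*b)\<bar> \<le> 10"
    proof -
      have "0 \<le> a*a" "0 \<le> a*b" "0 \<le> b*b" "a*a \<le> 2*2" "a*b \<le> 2*2" "b*b \<le> 2*2"
        using that by (intro mult_mono mult_nonneg_nonneg; simp)+
      then show ?thesis using that unfolding abs_le_iff distrib_left by (intro conjI; linarith)
    qed
    ultimately show ?thesis by (simp add: abs_mult mult_right_mono)
  qed
  have P_bound: "\<bar>P a\<bar> \<le> 1" if "0 \<le> a" "a \<le> 1" for a
  proof -
    have a: "0 \<le> a * a" "a * a \<le> a" "a * a * a \<le> a * a"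
      using that mult_right_mono[of a 1 a] mult_right_mono[of a 1 "a * a"] by (auto simp: mult_ac)
    have "0 \<le> (1 - a) * (1 + a - 3/2 * (a * a))"
      using a that by (intro mult_nonneg_nonneg) linarith+
    also have "\<dots> = P a" by (simp add: P_def power2_eq_square power3_eq_cube field_simps)
    finally have "0 \<le> P a" .
    moreover have "P a \<le> 1" using a unfolding P_def power2_eq_square power3_eq_cube by linarith
    ultimately show ?thesis by simp
  qed
  have Q_bound: "\<bar>Q a\<bar> \<le> 1" if "1 \<le> a" "a \<le> 2" for a
  proof -
    have "\<bar>(2 - a)\<^sup>2 * (1 - a)\<bar> \<le> 1 * 1"
      unfolding abs_mult using that by (intro mult_mono) (auto simp: abs_square_le_1)
    then show ?thesis by (simp add: Q_def abs_mult)
  qed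
  have bound: "\<bar>M4' s\<bar> \<le> 1" for s
    using P_bound[of "\<bar>s\<bar>"] Q_bound[of "\<bar>s\<bar>"] by (auto simp: M4'_def P_def Q_def)
  show ?thesis
    unfolding lipschitz_profile_def
  proof (intro conjI allI impI)
    fix s t
    show "\<bar>M4' s\<bar> \<le> 1" by (rule bound)
    show "M4' s = 0" if "\<bar>s\<bar> > 2" using that by (simp add: M4'_def)
    have "\<bar>M4' s - M4' t\<bar> \<le> \<bar>P (lo s) - P (lo t)\<bar> + \<bar>Q (hi s) - Q (hi t)\<bar>"
      unfolding eq by linarith
    also have "\<dots> \<le> 10 * \<bar>lo s - lo t\<bar> + 10 * \<bar>hi s - hi t\<bar>"
      by (intro add_mono P Q) (auto simp: lo_def hi_def)
    also have "\<dots> \<le> 20 * \<bar>s - t\<bar>"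
    proof -
      have "\<bar>lo s - lo t\<bar> \<le> \<bar>s - t\<bar>" "\<bar>hi s - hi t\<bar> \<le> \<bar>s - t\<bar>"
        unfolding lo_def hi_def by linarith+
      then have "10 * \<bar>lo s - lo t\<bar> + 10 * \<bar>hi s - hi t\<bar> \<le> 10 * \<bar>s - t\<bar> + 10 * \<bar>s - t\<bar>"
        by (intro add_mono mult_left_mono) auto
      then show ?thesis by simp
    qed
    finally show "\<bar>M4' s - M4' t\<bar> \<le> 20 * \<bar>s - t\<bar>" .
  qed
qed

lemma tensor_diff_le:
  fixes x y :: "real^'d"
  assumes b: "lipschitz_profile \<rho> L b" and r: "\<And>i. \<bar>x $ i - y $ i\<bar> \<le> r"
  shows "\<bar>tensor b x - tensor b y\<bar> \<le> real CARD('d) * (L * r)"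
proof -
  have "0 \<le> \<bar>b 1 - b 0\<bar>" by simp
  also have "\<dots> \<le> L * \<bar>1 - 0\<bar>" using b unfolding lipschitz_profile_def by blast
  finally have L: "0 \<le> L" by simp
  have "\<bar>tensor b x - tensor b y\<bar> \<le> (\<Sum>i\<in>UNIV. \<bar>b (x $ i) - b (y $ i)\<bar>)"
    using norm_prod_diff[of UNIV "\<lambda>i. b (x $ i)" "\<lambda>i. b (y $ i)"] b
    by (simp add: tensor_def lipschitz_profile_def)
  also have "\<dots> \<le> (\<Sum>i\<in>(UNIV::'d set). L * r)"
  proof (rule sum_mono)
    fix i
    have "\<bar>b (x $ i) - b (y $ i)\<bar> \<le> L * \<bar>x $ i - y $ i\<bar>"
      using b by (simp add: lipschitz_profile_def)
    also have "\<dots> \<le> L * r" by (rule mult_left_mono[OF r L])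
    finally show "\<bar>b (x $ i) - b (y $ i)\<bar> \<le> L * r" .
  qed
  finally show ?thesis by simp
qed

lemma scaled_tensor_diff_le:
  fixes x y :: "real^'d"
  assumes "lipschitz_profile \<rho> L b" "h > 0" "\<And>i. \<bar>(x - y) $ i\<bar> \<le> r"
  shows "\<bar>scaled (tensor b) h x - scaled (tensor b) h y\<bar>
         \<le> (1 / h) ^ CARD('d) * (real CARD('d) * (L * (r / h)))"
proof -
  have "\<bar>tensor b ((1 / h) *\<^sub>R x) - tensor b ((1 / h) *\<^sub>R y)\<bar> \<le> real CARD('d) * (L * (r / h))"
  proof (rule tensor_diff_le[OF assms(1)])
    fix i
    have "\<bar>((1 / h) *\<^sub>R x) $ i - ((1 / h) *\<^sub>R y) $ i\<bar> = \<bar>(x - y) $ i\<bar> / h"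
      using assms(2) by (simp add: diff_divide_distrib[symmetric] abs_divide)
    also have "\<dots> \<le> r / h" using assms by (intro divide_right_mono) auto
    finally show "\<bar>((1 / h) *\<^sub>R x) $ i - ((1 / h) *\<^sub>R y) $ i\<bar> \<le> r / h" .
  qed
  then have "(1 / h) ^ CARD('d) * \<bar>tensor b ((1 / h) *\<^sub>R x) - tensor b ((1 / h) *\<^sub>R y)\<bar>
      \<le> (1 / h) ^ CARD('d) * (real CARD('d) * (L * (r / h)))"
    using assms(2) by (intro mult_left_mono) auto
  then show ?thesis
    using assms(2) unfolding scaled_def right_diff_distrib[symmetric] abs_mult by simp
qed

lemma scaled_tensor_support:
  fixes x :: "real^'d"
  assumes "lipschitz_profile \<rho> L b" "h > 0" "scaled (tensor b) h x \<noteq> 0"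
  shows "\<bar>x $ i\<bar> \<le> h * \<rho>"
proof -
  have "b (x $ i / h) \<noteq> 0"
    using assms(3) by (auto simp: scaled_def tensor_def)
  then have "\<bar>x $ i / h\<bar> \<le> \<rho>"
    using assms(1) unfolding lipschitz_profile_def by (meson not_le)
  then show ?thesis using assms(2) by (simp add: abs_divide field_simps)
qed

lemma scaled_tensor_continuous:
  assumes "lipschitz_profile \<rho> L b"
  shows "continuous_on UNIV (scaled (tensor b) h)"
proof -
  note b = continuous_on_compose2[OF lipschitz_profile_continuous[OF assms]]
  show ?thesis
    unfolding scaled_def tensor_def by (intro continuous_intros b) auto
qed

section \<open>Lattice sums and weights\<close>

text \<open>Partial sums along an enumeration of the index set are eventually constant at each point.\<close>

lemma borel_measurable_infsum_finite_support:
  fixes G :: "'k::countable \<Rightarrow> 'a \<Rightarrow> real"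
  assumes G: "\<And>k. G k \<in> borel_measurable M"
    and fin: "\<And>x. x \<in> space M \<Longrightarrow> finite {k. G k x \<noteq> 0}"
  shows "(\<lambda>x. \<Sum>\<^sub>\<infinity>k. G k x) \<in> borel_measurable M"
proof (rule borel_measurable_LIMSEQ_real)
  let ?I = "\<lambda>n. {k :: 'k. to_nat k < n}"
  have I: "finite (?I n)" for n
    using finite_vimageI[of "{..<n}" "to_nat :: 'k \<Rightarrow> nat"] by (simp add: vimage_def)
  show "(\<lambda>x. \<Sum>k\<in>?I n. G k x) \<in> borel_measurable M" for n
    using G by measurable
  fix x assume x: "x \<in> space M"
  obtain N where N: "to_nat ` {k. G k x \<noteq> 0} \<subseteq> {..<N}"
    using finite_nat_iff_bounded fin[OF x] by blast
  have "(\<Sum>k\<in>?I n. G k x) = (\<Sum>\<^sub>\<infinity>k. G k x)" if "n \<ge> N" for n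
  proof -
    have "(\<Sum>\<^sub>\<infinity>k. G k x) = (\<Sum>\<^sub>\<infinity>k\<in>?I n. G k x)"
      using N that by (intro infsum_cong_neutral) force+
    then show ?thesis using I by simp
  qed
  then show "(\<lambda>n. \<Sum>k\<in>?I n. G k x) \<longlonglongrightarrow> (\<Sum>\<^sub>\<infinity>k. G k x)"
    by (intro tendsto_eventually) (auto simp: eventually_sequentially)
qed

lemma vec_box_eq_image:
  "{k :: 'a^'d. \<forall>i. k $ i \<in> S i} = vec_lambda ` (PiE UNIV S)"
proof (rule set_eqI)
  fix k :: "'a^'d"
  show "k \<in> {k. \<forall>i. k $ i \<in> S i} \<longleftrightarrow> k \<in> vec_lambda ` (PiE UNIV S)"
    by (auto intro!: image_eqI[of k vec_lambda "vec_nth k"])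
qed

lemma finite_vec_box:
  fixes S :: "'d::finite \<Rightarrow> 'a set"
  assumes "\<And>i. finite (S i)"
  shows "finite {k :: 'a^'d. \<forall>i. k $ i \<in> S i}"
  unfolding vec_box_eq_image using assms by (intro finite_imageI finite_PiE) auto

lemma card_vec_box_le:
  fixes S :: "'d::finite \<Rightarrow> 'a set"
  assumes "\<And>i. finite (S i)"
  shows "card {k :: 'a^'d. \<forall>i. k $ i \<in> S i} \<le> (\<Prod>i\<in>UNIV. card (S i))"
  unfolding vec_box_eq_image
  using card_image_le[OF finite_PiE[of UNIV S]] assms by (simp add: card_PiE)

text \<open>An interval of length \<open>2 * R\<close> contains at most \<open>2 * R + 1\<close> integers.\<close>

lemma lattice_points_in_cube:
  fixes y :: "real^'d"
  assumes "0 \<le> R"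
  defines "K \<equiv> {k :: int^'d. \<forall>i. \<bar>y $ i - real_of_int (k $ i)\<bar> \<le> R}"
  shows "finite K" "real (card K) \<le> (2 * R + 1) ^ CARD('d)"
proof -
  let ?S = "\<lambda>i. {\<lceil>y $ i - R\<rceil>..\<lfloor>y $ i + R\<rfloor>}"
  have K: "K = {k. \<forall>i. k $ i \<in> ?S i}"
    unfolding K_def by (auto simp: abs_le_iff ceiling_le_iff le_floor_iff algebra_simps)
  show "finite K" unfolding K by (rule finite_vec_box) simp
  have S: "real (card (?S i)) \<le> 2 * R + 1" for i
    using assms(1) by simp linarith
  have "real (card K) \<le> real (\<Prod>i\<in>UNIV. card (?S i))"
    unfolding K by (intro of_nat_mono card_vec_box_le) simp
  also have "\<dots> \<le> (\<Prod>i\<in>(UNIV::'d set). 2 * R + 1)"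
    unfolding of_nat_prod using S by (intro prod_mono) auto
  finally show "real (card K) \<le> (2 * R + 1) ^ CARD('d)" by simp
qed

text \<open>Everything the estimate uses about a scheme, with constants depending on the scheme only. Up
  to the factor \<open>h ^ CARD('d)\<close>, the weights are a fixed finite combination of point values of \<open>g\<close>,
  hence bounded by the absolute sum of its coefficients.\<close>

lemma particle_scheme_uniform_bounds:
  fixes \<phi> :: "real^'d \<Rightarrow> real"
  assumes "particle_scheme \<phi> W"
  obtains b \<rho> L K where "\<phi> = tensor b" "lipschitz_profile \<rho> L b" "\<rho> > 0" "L > 0" "K > 0"
    "\<And>h g M k. h > 0 \<Longrightarrow> (\<And>x. \<bar>g x\<bar> \<le> M) \<Longrightarrow> \<bar>W h g k\<bar> \<le> h ^ CARD('d) * (K * M)"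
  using assms
proof cases
  case (Bspline p a m)
  define S where "S = {l :: int^'d. \<forall>i. \<bar>l $ i\<bar> \<le> int m}"
  \<comment> \<open>The summand \<open>1\<close> only makes \<open>K\<close> positive.\<close>
  define K where "K = 1 + (\<Sum>l\<in>S. \<bar>\<Prod>i\<in>UNIV. a (l $ i)\<bar>)"
  have "K > 0" unfolding K_def by (intro add_pos_nonneg sum_nonneg) auto
  obtain q where q: "p = Suc q" using Bspline(3) by (cases p) auto
  have W: "\<bar>quasi_weights m a h g k\<bar> \<le> h ^ CARD('d) * (K * M)"
    if "h > 0" "\<And>x. \<bar>g x\<bar> \<le> M" for h :: real and g :: "real^'d \<Rightarrow> real" and M k
  proof -
    have "0 \<le> M" using that(2)[of 0] by linarith
    have "\<bar>\<Sum>l\<in>S. (\<Prod>i\<in>UNIV. a (l $ i)) * g (grid h (k + l))\<bar>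
        \<le> (\<Sum>l\<in>S. \<bar>(\<Prod>i\<in>UNIV. a (l $ i)) * g (grid h (k + l))\<bar>)" by (rule sum_abs)
    also have "\<dots> \<le> (\<Sum>l\<in>S. \<bar>\<Prod>i\<in>UNIV. a (l $ i)\<bar> * M)"
      by (intro sum_mono) (auto simp: abs_mult intro!: mult_left_mono that(2))
    also have "\<dots> \<le> K * M"
      using \<open>0 \<le> M\<close> by (simp add: K_def sum_distrib_right[symmetric] distrib_right)
    finally show ?thesis
      using that(1) by (simp add: quasi_weights_def S_def abs_mult)
  qed
  show thesis
    using that[OF _ bspline_lipschitz_profile[of q] _ _ \<open>K > 0\<close>] W Bspline q by simp
next
  case M4'
  have "\<bar>point_weights h g k\<bar> \<le> h ^ CARD('d) * (1 * M)"
    if "h > 0" "\<And>x. \<bar>g x\<bar> \<le> M" for h :: real and g :: "real^'d \<Rightarrow> real" and M k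
    using that by (simp add: point_weights_def abs_mult)
  then show thesis
    using that[OF _ M4'_lipschitz_profile, of 1] M4' by simp
qed

section \<open>Linearising the inverse flow\<close>

locale C2_inverse_pair =
  fixes F B :: "real^'d \<Rightarrow> real^'d"
  assumes BF: "\<And>x. B (F x) = x" and FB: "\<And>x. F (B x) = x"
    and C1: "Ck_map 1 F" and C2: "Ck_map 2 B"
begin

lemma F_regular: "F differentiable at x" "(\<lambda>x. F x $ i) differentiable_on UNIV"
  using Ck_map_differentiable[of 0 F] C1 by simp_all

lemma B_regular:
  "B differentiable at x" "(\<lambda>x. B x $ i) differentiable_on UNIV"
  "partial j (\<lambda>x. B x $ i) differentiable_on UNIV"
  using Ck_map_differentiable[of 1 B] C2 by (simp_all add: Ck_map_def numeral_2_eq_2)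

lemma B_continuous: "continuous_on UNIV B"
  using B_regular(1) by (intro differentiable_imp_continuous_on)
    (simp add: differentiable_on_def differentiable_at_withinI)

lemma inverse_jacobian_eq: "matrix_inv (jacobian F (at z)) = jacobian B (at (F z))"
  using jacobian_inverse[OF BF F_regular(1) B_regular(1)] by blast

lemma inverse_jacobian_mult_nth:
  "(matrix_inv (jacobian F (at z)) *v v) $ i
     = (\<Sum>j\<in>UNIV. partial j (\<lambda>x. B x $ i) (F z) * v $ j)"
  by (simp add: inverse_jacobian_eq matrix_vector_mult_def jacobian_entry B_regular)

lemma jacobian_mult_inverse_nth:
  "v $ i = (\<Sum>j\<in>UNIV. partial j (\<lambda>x. F x $ i) z * (matrix_inv (jacobian F (at z)) *v v) $ j)"
proof -
  have "jacobian F (at z) *v (matrix_inv (jacobian F (at z)) *v v) = v"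
    using jacobian_inverse[OF BF F_regular(1) B_regular(1)]
    by (simp add: matrix_vector_mul_assoc)
  then have "v $ i = (jacobian F (at z) *v (matrix_inv (jacobian F (at z)) *v v)) $ i" by simp
  also have "\<dots> = (\<Sum>j\<in>UNIV. partial j (\<lambda>x. F x $ i) z * (matrix_inv (jacobian F (at z)) *v v) $ j)"
    by (subst matrix_vector_mult_def) (simp add: jacobian_entry F_regular)
  finally show ?thesis .
qed

abbreviation linearised_position :: "real^'d \<Rightarrow> real^'d \<Rightarrow> real^'d" where
  "linearised_position z x \<equiv> matrix_inv (jacobian F (at z)) *v (x - F z)"

text \<open>Seen from the particle centre \<open>z\<close>, the LTP operator evaluates the shape at the first-order Taylor
  polynomial of \<open>B\<close> at \<open>F z\<close>, the exact operator at \<open>B x - z\<close>; the difference is the Taylor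
  remainder.\<close>

lemma linearised_position_error:
  assumes \<beta>: "\<And>i x. (\<Sum>j\<in>UNIV. \<Sum>l\<in>UNIV. \<bar>partial l (partial j (\<lambda>x. B x $ i)) x\<bar>) \<le> \<beta>"
    and r: "\<And>j. \<bar>(x - F z) $ j\<bar> \<le> r"
  shows "\<bar>(linearised_position z x - (B x - z)) $ i\<bar> \<le> \<beta> * r\<^sup>2"
proof -
  have "(linearised_position z x - (B x - z)) $ i
      = - (B x $ i - B (F z) $ i - (\<Sum>j\<in>UNIV. partial j (\<lambda>x. B x $ i) (F z) * (x - F z) $ j))"
    by (simp add: inverse_jacobian_mult_nth BF)
  then show ?thesis
    using linearisation_bound[OF B_regular(2,3) \<beta> r, of i] by (simp only: abs_minus_cancel)
qed

text \<open>Whichever of the two transported particles does not vanish at \<open>x\<close>, the point \<open>x\<close> is close to the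
  transported centre \<open>F z\<close>: the linearised position is mapped back by the Jacobian of \<open>F\<close>, the
  exact one by \<open>F\<close> itself, and both stretch distances by at most \<open>A\<close>.\<close>

lemma displacement_le:
  assumes A: "\<And>i x. (\<Sum>j\<in>UNIV. \<bar>partial j (\<lambda>x. F x $ i) x\<bar>) \<le> A"
    and s: "(\<forall>i. \<bar>linearised_position z x $ i\<bar> \<le> s) \<or> (\<forall>i. \<bar>(B x - z) $ i\<bar> \<le> s)"
  shows "\<bar>(x - F z) $ j\<bar> \<le> A * s"
  using s
proof
  assume s: "\<forall>i. \<bar>linearised_position z x $ i\<bar> \<le> s"
  then have "0 \<le> s" using abs_ge_zero order_trans by blast
  then show ?thesis
    by (subst jacobian_mult_inverse_nth[of _ _ z]) (use A s in \<open>auto intro: abs_sum_mult_le\<close>)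
next
  assume s: "\<forall>i. \<bar>(B x - z) $ i\<bar> \<le> s"
  then show ?thesis using increment_bound[OF F_regular(2) A, of "B x" z s j] by (simp add: FB)
qed

end

text \<open>If the second derivatives of \<open>B\<close> vanish, then \<open>B\<close> is its own linearisation. This
  also settles the product \<open>\<infinity> * 0 = 0\<close> of semi-norms.\<close>

lemma (in C2_inverse_pair) ltp_exact_if_affine:
  assumes "\<And>i x. (\<Sum>j\<in>UNIV. \<Sum>l\<in>UNIV. \<bar>partial l (partial j (\<lambda>x. B x $ i)) x\<bar>) \<le> 0"
  shows "ltp_transport F \<phi> h w x = exact_transport B (particle_sum \<phi> h w) x"
proof -
  have "linearised_position z x = B x - z" for z
  proof -
    have "\<bar>(linearised_position z x - (B x - z)) $ i\<bar> \<le> 0 * (norm (x - F z))\<^sup>2" for i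
      by (rule linearised_position_error[OF assms]) (rule component_le_norm_cart)
    then show ?thesis by (simp add: vec_eq_iff)
  qed
  then show ?thesis
    by (simp add: ltp_transport_def exact_transport_def particle_sum_def)
qed

text \<open>An injective map is not constant; this excludes the product \<open>0 * \<infinity> = 0\<close> of semi-norms.\<close>

lemma (in C2_inverse_pair) gradient_bound_nonzero:
  assumes A: "\<And>i x. (\<Sum>j\<in>UNIV. \<bar>partial j (\<lambda>x. F x $ i) x\<bar>) \<le> A"
  shows "A \<noteq> 0"
proof
  assume "A = 0"
  have "\<bar>F x $ i - F y $ i\<bar> \<le> A * norm (x - y)" for x y i
    by (rule increment_bound[OF F_regular(2) A]) (rule component_le_norm_cart)
  then have "F x = F y" for x y using \<open>A = 0\<close> by (simp add: vec_eq_iff)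
  then have "(1 :: real^'d) = 0" by (metis BF)
  then show False by simp
qed

section \<open>The error of transported particle sums\<close>

text \<open>Here both semi-norms are finite: \<open>A\<close> and \<open>\<beta>\<close> bound the first derivatives of \<open>F\<close> and the second
  derivatives of \<open>B\<close>, and \<open>h ^ CARD('d) * Q\<close> bounds the weights. The power of \<open>h\<close> cancels the
  normalisation of the scaled shape.\<close>

locale particle_transport = C2_inverse_pair F B
  for F B :: "real^'d \<Rightarrow> real^'d" +
  fixes b :: "real \<Rightarrow> real" and \<rho> L h A \<beta> Q :: real and w :: "int^'d \<Rightarrow> real"
  assumes profile: "lipschitz_profile \<rho> L b" and \<rho>: "\<rho> > 0" and L: "L > 0" and h: "h > 0"
    and A: "\<And>i x. (\<Sum>j\<in>UNIV. \<bar>partial j (\<lambda>x. F x $ i) x\<bar>) \<le> A"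
    and \<beta>: "\<And>i x. (\<Sum>j\<in>UNIV. \<Sum>l\<in>UNIV. \<bar>partial l (partial j (\<lambda>x. B x $ i)) x\<bar>) \<le> \<beta>"
    and w: "\<And>k. \<bar>w k\<bar> \<le> h ^ CARD('d) * Q"
begin

definition c\<^sub>F :: real where "c\<^sub>F = A\<^sup>2 * \<beta>"

lemma c_F_nonneg: "0 \<le> c\<^sub>F"
proof -
  have "0 \<le> (\<Sum>j\<in>UNIV. \<Sum>l\<in>UNIV. \<bar>partial l (partial j (\<lambda>x. B x $ undefined)) undefined\<bar>)"
    by (intro sum_nonneg) simp
  then have "0 \<le> \<beta>" using \<beta> order_trans by blast
  then show ?thesis by (simp add: c\<^sub>F_def)
qed

lemma Q_nonneg: "0 \<le> Q"
proof -
  have "0 \<le> h ^ CARD('d) * Q" using w[of undefined] by linarith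
  then show ?thesis using zero_less_power[OF h, of "CARD('d)"] by (simp add: zero_le_mult_iff)
qed

abbreviation ltp_term :: "real^'d \<Rightarrow> int^'d \<Rightarrow> real" where
  "ltp_term x k \<equiv> w k * scaled (tensor b) h (linearised_position (grid h k) x)"

abbreviation exact_term :: "real^'d \<Rightarrow> int^'d \<Rightarrow> real" where
  "exact_term x k \<equiv> w k * scaled (tensor b) h (B x - grid h k)"

text \<open>The particles whose centre lies within \<open>h * \<rho> * (1 + \<rho> * h * c\<^sub>F)\<close> of \<open>B x\<close>: the support
  radius \<open>h * \<rho>\<close> of the exact particles, enlarged by the position error of the linearised ones.\<close>

definition relevant :: "real^'d \<Rightarrow> (int^'d) set" where
  "relevant x = {k. \<forall>i. \<bar>((1 / h) *\<^sub>R B x) $ i - real_of_int (k $ i)\<bar> \<le> \<rho> * (1 + \<rho> * (h * c\<^sub>F))}"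

lemma position_error_near_support:
  assumes "ltp_term x k \<noteq> 0 \<or> exact_term x k \<noteq> 0"
  shows "\<bar>(linearised_position (grid h k) x - (B x - grid h k)) $ i\<bar> \<le> h\<^sup>2 * \<rho>\<^sup>2 * c\<^sub>F"
proof -
  have "(\<forall>i. \<bar>linearised_position (grid h k) x $ i\<bar> \<le> h * \<rho>) \<or> (\<forall>i. \<bar>(B x - grid h k) $ i\<bar> \<le> h * \<rho>)"
    using assms scaled_tensor_support[OF profile h] by (metis mult_zero_right)
  from linearised_position_error[OF \<beta> displacement_le[OF A this]]
  show ?thesis by (simp add: c\<^sub>F_def power_mult_distrib mult_ac)
qed

lemma support_relevant:
  assumes "ltp_term x k \<noteq> 0 \<or> exact_term x k \<noteq> 0"
  shows "k \<in> relevant x"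
  unfolding relevant_def
proof (intro CollectI allI)
  fix i
  have "\<bar>(B x - grid h k) $ i\<bar> \<le> h * \<rho> + h\<^sup>2 * \<rho>\<^sup>2 * c\<^sub>F"
    using assms
  proof
    assume "ltp_term x k \<noteq> 0"
    then have "\<bar>linearised_position (grid h k) x $ i\<bar> \<le> h * \<rho>"
      using scaled_tensor_support[OF profile h] by (metis mult_zero_right)
    then show ?thesis using position_error_near_support[OF assms, of i] by simp
  next
    assume "exact_term x k \<noteq> 0"
    then have "\<bar>(B x - grid h k) $ i\<bar> \<le> h * \<rho>"
      using scaled_tensor_support[OF profile h] by (metis mult_zero_right)
    moreover have "0 \<le> h\<^sup>2 * \<rho>\<^sup>2 * c\<^sub>F" using c_F_nonneg by simp
    ultimately show ?thesis by linarith
  qed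
  moreover have "(B x - grid h k) $ i = h * (((1 / h) *\<^sub>R B x) $ i - real_of_int (k $ i))"
    using h by (simp add: grid_def right_diff_distrib)
  moreover have "h * \<rho> + h\<^sup>2 * \<rho>\<^sup>2 * c\<^sub>F = h * (\<rho> * (1 + \<rho> * (h * c\<^sub>F)))"
    by (simp add: power2_eq_square algebra_simps)
  ultimately show "\<bar>((1 / h) *\<^sub>R B x) $ i - real_of_int (k $ i)\<bar> \<le> \<rho> * (1 + \<rho> * (h * c\<^sub>F))"
    using h by (simp add: abs_mult)
qed

text \<open>This is where the factor \<open>(1 + h * c\<^sub>F) ^ CARD('d)\<close> comes from: linearisation can enlarge the
  number of overlapping particles.\<close>

lemma relevant_card:
  "finite (relevant x)"
  "real (card (relevant x)) \<le> ((2 * \<rho>\<^sup>2 + 2 * \<rho> + 1) * (1 + h * c\<^sub>F)) ^ CARD('d)"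
proof -
  have hc: "0 \<le> h * c\<^sub>F" using h c_F_nonneg by simp
  then have R: "0 \<le> \<rho> * (1 + \<rho> * (h * c\<^sub>F))" using \<rho> by simp
  show "finite (relevant x)" unfolding relevant_def by (rule lattice_points_in_cube[OF R])
  have "real (card (relevant x)) \<le> (2 * (\<rho> * (1 + \<rho> * (h * c\<^sub>F))) + 1) ^ CARD('d)"
    unfolding relevant_def by (rule lattice_points_in_cube[OF R])
  also have "\<dots> \<le> ((2 * \<rho>\<^sup>2 + 2 * \<rho> + 1) * (1 + h * c\<^sub>F)) ^ CARD('d)"
  proof (intro power_mono)
    have "0 \<le> \<rho> * (h * c\<^sub>F)" using hc \<rho> by simp
    then show "2 * (\<rho> * (1 + \<rho> * (h * c\<^sub>F))) + 1 \<le> (2 * \<rho>\<^sup>2 + 2 * \<rho> + 1) * (1 + h * c\<^sub>F)"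
      using hc by (simp add: power2_eq_square algebra_simps)
  qed (use R in simp)
  finally show "real (card (relevant x)) \<le> ((2 * \<rho>\<^sup>2 + 2 * \<rho> + 1) * (1 + h * c\<^sub>F)) ^ CARD('d)" .
qed

text \<open>The position error of order \<open>h\<^sup>2\<close> meets a scaled shape whose Lipschitz constant exceeds its size
  by a factor of order \<open>1 / h\<close>, which leaves one power of \<open>h\<close>.\<close>

lemma term_error:
  "\<bar>ltp_term x k - exact_term x k\<bar> \<le> Q * (real CARD('d) * (L * \<rho>\<^sup>2 * (h * c\<^sub>F)))"
proof (cases "ltp_term x k \<noteq> 0 \<or> exact_term x k \<noteq> 0")
  case True
  let ?E = "real CARD('d) * (L * (h\<^sup>2 * \<rho>\<^sup>2 * c\<^sub>F / h))"
  have "\<bar>ltp_term x k - exact_term x k\<bar> = \<bar>w k\<bar> * \<bar>scaled (tensor b) h (linearised_position (grid h k) x)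
      - scaled (tensor b) h (B x - grid h k)\<bar>"
    by (simp add: abs_mult[symmetric] right_diff_distrib)
  also have "\<dots> \<le> (h ^ CARD('d) * Q) * ((1 / h) ^ CARD('d) * ?E)"
    using w scaled_tensor_diff_le[OF profile h position_error_near_support[OF True]] h Q_nonneg
    by (intro mult_mono) auto
  also have "\<dots> = Q * (real CARD('d) * (L * \<rho>\<^sup>2 * (h * c\<^sub>F)))"
    using h by (simp add: power_divide power2_eq_square field_simps)
  finally show ?thesis .
next
  case False
  then show ?thesis using Q_nonneg L h c_F_nonneg by auto
qed

lemma ltp_eq_sum: "ltp_transport F (tensor b) h w x = (\<Sum>k\<in>relevant x. ltp_term x k)"
proof -
  have "ltp_transport F (tensor b) h w x = (\<Sum>\<^sub>\<infinity>k\<in>relevant x. ltp_term x k)"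
    unfolding ltp_transport_def using support_relevant by (intro infsum_cong_neutral) auto
  then show ?thesis using relevant_card(1) by simp
qed

lemma exact_eq_sum:
  "exact_transport B (particle_sum (tensor b) h w) x = (\<Sum>k\<in>relevant x. exact_term x k)"
proof -
  have "exact_transport B (particle_sum (tensor b) h w) x = (\<Sum>\<^sub>\<infinity>k\<in>relevant x. exact_term x k)"
    unfolding exact_transport_def particle_sum_def o_def
    using support_relevant by (intro infsum_cong_neutral) auto
  then show ?thesis using relevant_card(1) by simp
qed

lemma transport_error_pointwise:
  "\<bar>ltp_transport F (tensor b) h w x - exact_transport B (particle_sum (tensor b) h w) x\<bar>
   \<le> real CARD('d) * L * \<rho>\<^sup>2 * (2 * \<rho>\<^sup>2 + 2 * \<rho> + 1) ^ CARD('d) * h * c\<^sub>F * (1 + h * c\<^sub>F) ^ CARD('d) * Q"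
    (is "\<bar>?D\<bar> \<le> _")
proof -
  let ?E = "Q * (real CARD('d) * (L * \<rho>\<^sup>2 * (h * c\<^sub>F)))"
  have E: "0 \<le> ?E" using Q_nonneg L h c_F_nonneg by simp
  have "\<bar>?D\<bar> = \<bar>\<Sum>k\<in>relevant x. ltp_term x k - exact_term x k\<bar>"
    by (simp add: ltp_eq_sum exact_eq_sum sum_subtractf)
  also have "\<dots> \<le> (\<Sum>k\<in>relevant x. \<bar>ltp_term x k - exact_term x k\<bar>)" by (rule sum_abs)
  also have "\<dots> \<le> real (card (relevant x)) * ?E"
    by (rule sum_bounded_above) (rule term_error)
  also have "\<dots> \<le> ((2 * \<rho>\<^sup>2 + 2 * \<rho> + 1) * (1 + h * c\<^sub>F)) ^ CARD('d) * ?E"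
    by (rule mult_right_mono[OF relevant_card(2) E])
  also have "\<dots> = real CARD('d) * L * \<rho>\<^sup>2 * (2 * \<rho>\<^sup>2 + 2 * \<rho> + 1) ^ CARD('d) * h * c\<^sub>F * (1 + h * c\<^sub>F) ^ CARD('d) * Q"
    by (simp only: power_mult_distrib mult_ac)
  finally show ?thesis .
qed

lemma transport_error_measurable:
  "(\<lambda>x. ltp_transport F (tensor b) h w x - exact_transport B (particle_sum (tensor b) h w) x)
     \<in> borel_measurable borel"
proof -
  note cont = continuous_on_compose2[OF scaled_tensor_continuous[OF profile]]
    continuous_on_compose2[OF matrix_vector_mult_linear_continuous_on]
  have fin: "finite {k. ltp_term x k \<noteq> 0}" "finite {k. exact_term x k \<noteq> 0}" for x
    using support_relevant by (auto intro: finite_subset[OF _ relevant_card(1)[of x]])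
  have "(\<lambda>x. \<Sum>\<^sub>\<infinity>k. ltp_term x k) \<in> borel_measurable borel"
    by (intro borel_measurable_infsum_finite_support borel_measurable_continuous_onI fin
        continuous_intros cont) auto
  moreover have "(\<lambda>x. \<Sum>\<^sub>\<infinity>k. exact_term x k) \<in> borel_measurable borel"
    by (intro borel_measurable_infsum_finite_support borel_measurable_continuous_onI fin
        continuous_intros cont B_continuous) auto
  ultimately show ?thesis
    unfolding ltp_transport_def exact_transport_def particle_sum_def o_def
    by (rule borel_measurable_diff)
qed

end

section \<open>The LTP transport error\<close>

theorem theorem1:
  fixes \<phi> :: "real^'d \<Rightarrow> real"
    and W :: "real \<Rightarrow> (real^'d \<Rightarrow> real) \<Rightarrow> int^'d \<Rightarrow> real"
  assumes "particle_scheme \<phi> W"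
  shows "\<exists>C>0. \<forall>T \<Delta>t (u :: real \<Rightarrow> real^'d \<Rightarrow> real^'d) n h (f0 :: real^'d \<Rightarrow> real).
    T > 0 \<longrightarrow> \<Delta>t > 0 \<longrightarrow> real n * \<Delta>t \<le> T \<longrightarrow> h > 0 \<longrightarrow> bounded (range f0) \<longrightarrow>
    continuous_on ({0..T} \<times> UNIV) (\<lambda>(t, x). u t x) \<longrightarrow>
    (\<forall>t\<in>{0..T}. u t differentiable_on UNIV) \<longrightarrow>
    (\<forall>t\<in>{0..T}. \<forall>x. divergence (u t) x = 0) \<longrightarrow>
    well_posed T u \<longrightarrow>
    Ck_map 1 (F_ex T \<Delta>t u n) \<longrightarrow> Ck_map 2 (B_ex T \<Delta>t u n) \<longrightarrow>
    (let F = F_ex T \<Delta>t u n; B = B_ex T \<Delta>t u n; w = W h f0;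
         c = (seminorm 1 F)\<^sup>2 * seminorm 2 B
     in Linf_norm UNIV (\<lambda>x. ltp_transport F \<phi> h w x - exact_transport B (particle_sum \<phi> h w) x)
        \<le> ennreal C * ennreal h * c * (1 + ennreal h * c) ^ CARD('d)
            * ennreal (SUP x. \<bar>f0 x\<bar>))"
proof -
  obtain b \<rho> L K where \<phi>: "\<phi> = tensor b" and profile: "lipschitz_profile \<rho> L b"
    and pos: "\<rho> > 0" "L > 0" "K > 0"
    and W: "\<And>h g M k. h > 0 \<Longrightarrow> (\<And>x. \<bar>g x\<bar> \<le> M) \<Longrightarrow> \<bar>W h g k\<bar> \<le> h ^ CARD('d) * (K * M)"
    using particle_scheme_uniform_bounds[OF assms] by blast
  define C where "C = real CARD('d) * L * \<rho>\<^sup>2 * (2 * \<rho>\<^sup>2 + 2 * \<rho> + 1) ^ CARD('d) * K"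
  have "C > 0" unfolding C_def using pos by (simp add: add_pos_pos)
  moreover have "Linf_norm UNIV (\<lambda>x. ltp_transport F \<phi> h (W h f0) x
          - exact_transport B (particle_sum \<phi> h (W h f0)) x)
        \<le> ennreal C * ennreal h * c * (1 + ennreal h * c) ^ CARD('d) * ennreal (SUP x. \<bar>f0 x\<bar>)"
    if "\<Delta>t > 0" "real n * \<Delta>t \<le> T" and h: "h > 0" and f0: "bounded (range f0)"
      and wp: "well_posed T u"
      and F: "F = F_ex T \<Delta>t u n" "Ck_map 1 F" and B: "B = B_ex T \<Delta>t u n" "Ck_map 2 B"
      and c: "c = (seminorm 1 F)\<^sup>2 * seminorm 2 B"
    for T \<Delta>t h and u :: "real \<Rightarrow> real^'d \<Rightarrow> real^'d" and n f0 F B c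
  proof -
    let ?D = "\<lambda>x. ltp_transport F \<phi> h (W h f0) x - exact_transport B (particle_sum \<phi> h (W h f0)) x"
    define M where "M = (SUP x. \<bar>f0 x\<bar>)"
    have M: "\<bar>f0 x\<bar> \<le> M" for x
    proof -
      obtain a where "\<forall>x. \<bar>f0 x\<bar> \<le> a" using f0 by (auto simp: bounded_iff)
      then have "bdd_above (range (\<lambda>x. \<bar>f0 x\<bar>))" by (intro bdd_aboveI2[of _ _ a]) simp
      then show ?thesis unfolding M_def by (intro cSUP_upper) auto
    qed
    then have "0 \<le> M" using abs_ge_zero order_trans by blast
    have w: "\<bar>W h f0 k\<bar> \<le> h ^ CARD('d) * (K * M)" for k using W[OF h M] .
    have "bij F" unfolding F F_ex_def using wp \<open>\<Delta>t > 0\<close> \<open>real n * \<Delta>t \<le> T\<close>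
      by (intro bij_flow) (auto intro: order_trans[of _ "real n * \<Delta>t"])
    then interpret C2_inverse_pair F B
      using F(2) B(2) by unfold_locales
        (simp_all add: B(1) B_ex_def F(1)[symmetric] bij_is_inj bij_is_surj surj_f_inv_f)
    \<comment> \<open>In the extended nonnegative reals \<open>0 * \<infinity> = 0\<close>, so the right-hand side can vanish even though
      a factor is infinite. The first two cases deal with these products.\<close>
    consider (affine) "seminorm 2 B = 0" | (zero_datum) "M = 0"
      | (infinite) "seminorm 2 B \<noteq> 0" "M > 0" "seminorm 1 F = \<infinity> \<or> seminorm 2 B = \<infinity>"
      | (finite) "seminorm 1 F \<noteq> \<infinity>" "seminorm 2 B \<noteq> \<infinity>"
      using \<open>0 \<le> M\<close> by fastforce
    then show ?thesis
    proof cases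
      case affine
      then have "?D = (\<lambda>_. 0)"
        using ltp_exact_if_affine[OF seminorm_2_bound[OF B(2)]] by simp
      then show ?thesis by (simp add: Linf_norm_leI)
    next
      case zero_datum
      then have "W h f0 k = 0" for k using w[of k] by simp
      then have "?D = (\<lambda>_. 0)"
        by (simp add: ltp_transport_def exact_transport_def particle_sum_def)
      then show ?thesis by (simp add: Linf_norm_leI)
    next
      case infinite
      have "seminorm 1 F \<noteq> 0"
        using gradient_bound_nonzero[OF seminorm_1_bound[OF F(2), of 0]] by auto
      with infinite have "c = \<infinity>" by (auto simp: c ennreal_mult_eq_top_iff power_eq_top_ennreal)
      then show ?thesis
        using \<open>C > 0\<close> \<open>h > 0\<close> infinite(2)
        by (simp add: M_def[symmetric] ennreal_mult_eq_top_iff power_eq_top_ennreal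
            ennreal_mult_top ennreal_top_mult)
    next
      case finite
      then obtain A \<beta> where F1: "seminorm 1 F = ennreal A" "0 \<le> A"
        and B2: "seminorm 2 B = ennreal \<beta>" "0 \<le> \<beta>"
        by (cases "seminorm 1 F"; cases "seminorm 2 B") auto
      interpret particle_transport F B b \<rho> L h A \<beta> "K * M" "W h f0"
        by unfold_locales
          (use profile pos h w seminorm_1_bound[OF F(2) F1] seminorm_2_bound[OF B(2) B2] in auto)
      define r where "r = A\<^sup>2 * \<beta>"
      have "0 \<le> r" using B2(2) by (simp add: r_def)
      have c_eq: "c = ennreal r"
        unfolding c F1(1) B2(1) r_def using F1(2) B2(2) by (simp add: ennreal_power ennreal_mult)
      have factor: "1 + ennreal h * ennreal r = ennreal (1 + h * r)"
        using \<open>h > 0\<close> \<open>0 \<le> r\<close> by (simp add: ennreal_mult ennreal_plus)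
      have "ennreal C * ennreal h * c * (1 + ennreal h * c) ^ CARD('d) * ennreal M
          = ennreal (C * h * r * (1 + h * r) ^ CARD('d) * M)"
        unfolding c_eq factor using \<open>C > 0\<close> \<open>h > 0\<close> \<open>0 \<le> M\<close> \<open>0 \<le> r\<close>
        by (simp add: ennreal_mult ennreal_power del: ennreal_plus)
      moreover have "\<bar>?D x\<bar> \<le> C * h * r * (1 + h * r) ^ CARD('d) * M" for x
        using transport_error_pointwise[of x] unfolding \<phi> c\<^sub>F_def C_def r_def by (simp add: mult_ac)
      ultimately show ?thesis
        using transport_error_measurable unfolding \<phi> M_def[symmetric]
        by (intro Linf_norm_leI) (auto intro: ennreal_leI)
    qed
  qed
  ultimately show ?thesis unfolding Let_def by blast
qed

end
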